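(* Let $v$ be a valuation on a field $F$ with valuation ring $O_v$, let $E/F$ be a finite field extension, and let $R\subseteq E$ be a ring with field of fractions $E$ and $R\cap F=O_v$. Let $\mathcal W_R$ be the collection of all quasi-valuations $w$ on $E$ extending $v$ with $O_w=R$, and let $w_v\in\mathcal W_R$ be the filter quasi-valuation on $E$ induced by $(R,v)$. Then the equivalence class of $w_v$ is the coarsest (the minimum) in $\mathcal W_R/\sim$: $[w_v]\le[w]$ for every $w\in\mathcal W_R$; that is, for every $w\in\mathcal W_R$ and all $x,y\in E$, $w_v(x)<w_v(y)$ implies $w(x)<w(y)$.
   Context: A totally ordered abelian monoid is a commutative monoid $(M,+)$ with a total order such that $a\le b$ implies $a+c\le b+c$. One adjoins $\infty$, greater than all elements of $M$, with $m+\infty=\infty$. A quasi-valuation on a ring $A$ is a function $w:A\to M\cup\{\infty\}$, $M$ a totally ordered abelian monoid (depending on $w$), with $w(0)=\infty$, $w(xy)\ge w(x)+w(y)$ and $w(x+y)\ge\min\{w(x),w(y)\}$ for all $x,y\in A$. $w$ extends $v$ means that the value group $\Gamma_v$ of $v$ is contained in $M$ as an ordered submonoid and $w|_F=v$. $O_w=\{x\in E\mid w(x)\ge0\}$. On $\mathcal W_R$: $w_1\sim w_2$ iff for all $x,y\in E$, $w_1(x)<w_1(y)\Leftrightarrow w_2(x)<w_2(y)$. On $\mathcal W_R/\sim$: $[w_1]\le[w_2]$ ("$w_1$ is coarser than $w_2$") iff for all $x,y\in E$, $w_1(x)<w_1(y)$ implies $w_2(x)<w_2(y)$. Cut monoid.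 For a totally ordered abelian group $\Gamma$, a cut $\mathcal A=(\mathcal A^L,\mathcal A^R)$ is a partition of $\Gamma$ into two (possibly empty) subsets with $\alpha<\beta$ for all $\alpha\in\mathcal A^L,\beta\in\mathcal A^R$. $\mathcal M(\Gamma)$ is the set of all cuts, ordered by $\mathcal A\le\mathcal B$ iff $\mathcal A^L\subseteq\mathcal B^L$, with addition $(\mathcal A+\mathcal B)^L=\{\alpha+\beta\mid\alpha\in\mathcal A^L,\beta\in\mathcal B^L\}$. For $S\subseteq\Gamma$, $S^+$ is the smallest cut $\mathcal A$ with $S\subseteq\mathcal A^L$. $\Gamma$ embeds in $\mathcal M(\Gamma)$ via $\alpha\mapsto\{\alpha\}^+=((-\infty,\alpha],(\alpha,\infty))$; $\mathcal B-\alpha$ means $\mathcal B+(-\alpha)$, and $\infty-\alpha=\infty$. The adjoined $\infty$ is greater than the cut $(\Gamma,\emptyset)$. Filter quasi-valuation. For $0\ne x\in R$ let $S_x=\{a\in O_v\mid x\in aR\}$ and $w_v(x)=v(S_x)^+\in\mathcal M(\Gamma_v)$, where $v(S_x)=\{v(a)\mid a\in S_x\}$; $w_v(0)=\infty$. Every element of $E$ is of the form $rs^{-1}$ with $r\in R$, $0\ne s\in O_v$, and $w_v:E\to\mathcal M(\Gamma_v)\cup\{\infty\}$ is the well-defined function $w_v(rs^{-1})=w_v(r)-v(s)$; it belongs to $\mathcal W_R$. *)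

theory Defs
  imports "HOL-Algebra.Algebra" "HOL-Library.Lattice_Constructions"
begin

section \<open>Adjoining infinity to a totally ordered abelian monoid\<close>

text \<open>
  A totally ordered abelian monoid is a type of sort
  \<open>{linorder, ordered_comm_monoid_add}\<close>. The monoid \<open>M \<union> {\<infinity>}\<close> is the
  type \<open>'m top\<close> of HOL-Library, which already carries the order.
\<close>

hide_const (open) bot.Value bot.Bot
hide_const (open) flat_complete_lattice.Value flat_complete_lattice.Bot flat_complete_lattice.Top

notation top.Top (\<open>\<infinity>\<close>)

instantiation top :: (zero) zero
begin
definition zero_top :: "'a top" where "0 = Value 0"
instance ..
end

instantiation top :: (plus) plus
begin
definition plus_top :: "'a top \<Rightarrow> 'a top \<Rightarrow> 'a top" where
  "x + y = (case x of \<infinity> \<Rightarrow> \<infinity> | Value a \<Rightarrow> (case y of \<infinity> \<Rightarrow> \<infinity> | Value b \<Rightarrow> Value (a + b)))"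
instance ..
end

lemma plus_top_simps [simp]:
  "Value a + Value b = Value (a + b)"
  "\<infinity> + y = \<infinity>"
  "x + \<infinity> = \<infinity>"
  by (auto simp: plus_top_def split: top.splits)

instance top :: (comm_monoid_add) comm_monoid_add
proof
  fix a b c :: "'a top"
  show "a + b + c = a + (b + c)"
    by (cases a; cases b; cases c) (auto simp: add.assoc)
  show "a + b = b + a"
    by (cases a; cases b) (auto simp: add.commute)
  show "0 + a = a"
    by (cases a) (auto simp: zero_top_def)
qed

instance top :: (ordered_comm_monoid_add) ordered_comm_monoid_add
proof
  fix a b c :: "'a top"
  assume "a \<le> b"
  then show "c + a \<le> c + b"
    by (cases a; cases b; cases c) (auto intro: add_left_mono)
qed


section \<open>The cut monoid\<close>

typedef (overloaded) 'g cut =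
  "{(L :: 'g::linorder set, R :: 'g set).
      L \<union> R = UNIV \<and> L \<inter> R = {} \<and> (\<forall>\<alpha>\<in>L. \<forall>\<beta>\<in>R. \<alpha> < \<beta>)}"
  by (rule exI[of _ "({}, UNIV)"]) auto

definition cut_left :: "'g::linorder cut \<Rightarrow> 'g set" where
  "cut_left A = fst (Rep_cut A)"

definition cut_right :: "'g::linorder cut \<Rightarrow> 'g set" where
  "cut_right A = snd (Rep_cut A)"

text \<open>The cut with a prescribed left set, which has to be downward closed.\<close>

definition cut_of_left :: "'g::linorder set \<Rightarrow> 'g cut" where
  "cut_of_left L = Abs_cut (L, - L)"

lemma cut_right_eq: "cut_right A = - cut_left A"
  using Rep_cut[of A] by (auto simp: cut_left_def cut_right_def)

lemma cut_left_downward: "\<beta> \<in> cut_left A \<Longrightarrow> \<alpha> \<le> \<beta> \<Longrightarrow> \<alpha> \<in> cut_left A"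
  using Rep_cut[of A] by (fastforce simp: cut_left_def)

lemma cut_left_inject: "cut_left A = cut_left B \<longleftrightarrow> A = B"
proof
  assume "cut_left A = cut_left B"
  moreover from this have "cut_right A = cut_right B"
    by (simp add: cut_right_eq)
  ultimately have "Rep_cut A = Rep_cut B"
    unfolding cut_left_def cut_right_def by (rule prod_eqI)
  then show "A = B" by (simp add: Rep_cut_inject)
qed simp

lemma cut_left_of_left:
  assumes "\<And>\<alpha> \<beta>. \<beta> \<in> L \<Longrightarrow> \<alpha> \<le> \<beta> \<Longrightarrow> \<alpha> \<in> L"
  shows "cut_left (cut_of_left L) = L"
proof -
  have "(L, - L) \<in> {(L, R). L \<union> R = UNIV \<and> L \<inter> R = {} \<and> (\<forall>\<alpha>\<in>L. \<forall>\<beta>\<in>R. \<alpha> < \<beta>)}"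
    using assms by (auto simp: not_le[symmetric])
  then show ?thesis
    by (simp add: cut_left_def cut_of_left_def Abs_cut_inverse)
qed

instantiation cut :: (linorder) linorder
begin

definition less_eq_cut :: "'a cut \<Rightarrow> 'a cut \<Rightarrow> bool" where
  "A \<le> B \<longleftrightarrow> cut_left A \<subseteq> cut_left B"

definition less_cut :: "'a cut \<Rightarrow> 'a cut \<Rightarrow> bool" where
  "A < B \<longleftrightarrow> cut_left A \<subset> cut_left B"

instance
proof
  fix A B :: "'a cut"
  show "A \<le> B \<or> B \<le> A"
    unfolding less_eq_cut_def using cut_left_downward
    by (metis linear subsetI)
qed (auto simp: less_eq_cut_def less_cut_def cut_left_inject)

end

text \<open>\<open>S\<^sup>+\<close>, the smallest cut whose left set contains \<open>S\<close>.\<close>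

definition cut_above :: "'g::linorder set \<Rightarrow> 'g cut" where
  "cut_above S = (LEAST A. S \<subseteq> cut_left A)"

lemma cut_left_cut_above: "cut_left (cut_above S) = {\<alpha>. \<exists>\<beta>\<in>S. \<alpha> \<le> \<beta>}"
proof -
  let ?D = "{\<alpha>. \<exists>\<beta>\<in>S. \<alpha> \<le> \<beta>}"
  have D: "cut_left (cut_of_left ?D) = ?D"
    by (rule cut_left_of_left) (auto intro: order_trans)
  have "cut_above S = cut_of_left ?D"
    unfolding cut_above_def
  proof (rule Least_equality)
    show "S \<subseteq> cut_left (cut_of_left ?D)"
      unfolding D by auto
    show "cut_of_left ?D \<le> A" if "S \<subseteq> cut_left A" for A
      using that cut_left_downward unfolding less_eq_cut_def D by blast
  qed
  then show ?thesis using D by simp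
qed

text \<open>The embedding of \<open>\<Gamma>\<close> into the cut monoid.\<close>

definition principal_cut :: "'g::linorder \<Rightarrow> 'g cut" where
  "principal_cut \<alpha> = cut_above {\<alpha>}"

lemma cut_left_principal_cut: "cut_left (principal_cut \<alpha>) = {..\<alpha>}"
  by (auto simp: principal_cut_def cut_left_cut_above)

instantiation cut :: (linordered_ab_group_add) "{plus, zero}"
begin

definition plus_cut :: "'a cut \<Rightarrow> 'a cut \<Rightarrow> 'a cut" where
  "A + B = cut_of_left {\<alpha> + \<beta> | \<alpha> \<beta>. \<alpha> \<in> cut_left A \<and> \<beta> \<in> cut_left B}"

definition zero_cut :: "'a cut" where
  "0 = principal_cut 0"

instance ..

end

lemma cut_left_plus:
  "cut_left (A + B) = {\<alpha> + \<beta> | \<alpha> \<beta>. \<alpha> \<in> cut_left A \<and> \<beta> \<in> cut_left B}"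
  unfolding plus_cut_def
proof (rule cut_left_of_left)
  fix \<gamma> \<delta> :: 'a
  assume "\<delta> \<in> {\<alpha> + \<beta> | \<alpha> \<beta>. \<alpha> \<in> cut_left A \<and> \<beta> \<in> cut_left B}" and le: "\<gamma> \<le> \<delta>"
  then obtain \<alpha> \<beta> where *: "\<delta> = \<alpha> + \<beta>" "\<alpha> \<in> cut_left A" "\<beta> \<in> cut_left B"
    by blast
  have "\<gamma> - \<beta> \<le> \<alpha>" using le *(1) by (simp add: diff_le_eq)
  with *(2) have "\<gamma> - \<beta> \<in> cut_left A" by (rule cut_left_downward)
  moreover have "\<gamma> = (\<gamma> - \<beta>) + \<beta>" by simp
  ultimately show "\<gamma> \<in> {\<alpha> + \<beta> | \<alpha> \<beta>. \<alpha> \<in> cut_left A \<and> \<beta> \<in> cut_left B}"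
    using *(3) by blast
qed

instance cut :: (linordered_ab_group_add) ordered_comm_monoid_add
proof
  fix A B C :: "'a cut"
  show "A + B + C = A + (B + C)"
  proof (rule cut_left_inject[THEN iffD1], rule Set.set_eqI)
    fix x
    have "x \<in> cut_left (A + B + C) \<longleftrightarrow>
        (\<exists>a\<in>cut_left A. \<exists>b\<in>cut_left B. \<exists>c\<in>cut_left C. x = (a + b) + c)"
      unfolding cut_left_plus by blast
    also have "\<dots> \<longleftrightarrow>
        (\<exists>a\<in>cut_left A. \<exists>b\<in>cut_left B. \<exists>c\<in>cut_left C. x = a + (b + c))"
      by (simp add: add.assoc)
    also have "\<dots> \<longleftrightarrow> x \<in> cut_left (A + (B + C))"
      unfolding cut_left_plus by blast
    finally show "x \<in> cut_left (A + B + C) \<longleftrightarrow> x \<in> cut_left (A + (B + C))" .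
  qed
  show "A + B = B + A"
    by (rule cut_left_inject[THEN iffD1], unfold cut_left_plus) (use add.commute in blast)
  show "0 + A = A"
  proof (rule cut_left_inject[THEN iffD1], rule Set.set_eqI)
    fix x
    show "x \<in> cut_left (0 + A) \<longleftrightarrow> x \<in> cut_left A"
    proof
      assume "x \<in> cut_left (0 + A)"
      then obtain a b where "x = a + b" "a \<le> 0" "b \<in> cut_left A"
        by (auto simp: cut_left_plus zero_cut_def cut_left_principal_cut)
      then show "x \<in> cut_left A"
        using cut_left_downward[of b A x] by (simp add: add_le_same_cancel2)
    next
      assume "x \<in> cut_left A"
      moreover have "x = 0 + x" by simp
      ultimately show "x \<in> cut_left (0 + A)"
        unfolding cut_left_plus zero_cut_def cut_left_principal_cut by blast
    qed
  qed
  show "C + A \<le> C + B" if "A \<le> B"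
    using that unfolding less_eq_cut_def cut_left_plus by blast
qed


section \<open>Valuations and quasi-valuations\<close>

text \<open>
  The type \<open>'g\<close> is the value group \<open>\<Gamma>\<^sub>v\<close> itself, not merely a group containing
  the values; this is the last conjunct.
\<close>

definition valuation ::
    "('a, 'b) ring_scheme \<Rightarrow> ('a \<Rightarrow> 'g::linordered_ab_group_add top) \<Rightarrow> bool" where
  "valuation K v \<longleftrightarrow>
     field K \<and>
     (\<forall>x\<in>carrier K. v x = \<infinity> \<longleftrightarrow> x = \<zero>\<^bsub>K\<^esub>) \<and>
     (\<forall>x\<in>carrier K. \<forall>y\<in>carrier K. v (x \<otimes>\<^bsub>K\<^esub> y) = v x + v y) \<and>
     (\<forall>x\<in>carrier K. \<forall>y\<in>carrier K. v (x \<oplus>\<^bsub>K\<^esub> y) \<ge> min (v x) (v y)) \<and>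
     (\<forall>\<gamma>. \<exists>x\<in>carrier K. v x = Value \<gamma>)"

definition quasi_valuation ::
    "('a, 'b) ring_scheme \<Rightarrow> ('a \<Rightarrow> 'm::{linorder, ordered_comm_monoid_add} top) \<Rightarrow> bool" where
  "quasi_valuation A w \<longleftrightarrow>
     ring A \<and>
     w \<zero>\<^bsub>A\<^esub> = \<infinity> \<and>
     (\<forall>x\<in>carrier A. \<forall>y\<in>carrier A. w (x \<otimes>\<^bsub>A\<^esub> y) \<ge> w x + w y) \<and>
     (\<forall>x\<in>carrier A. \<forall>y\<in>carrier A. w (x \<oplus>\<^bsub>A\<^esub> y) \<ge> min (w x) (w y))"

text \<open>\<open>O\<^sub>v\<close> and \<open>O\<^sub>w\<close>.\<close>

definition val_ring ::
    "('a, 'b) ring_scheme \<Rightarrow> ('a \<Rightarrow> 'm::{linorder, ordered_comm_monoid_add} top) \<Rightarrow> 'a set" where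
  "val_ring A w = {x \<in> carrier A. 0 \<le> w x}"

definition ordered_monoid_embedding ::
    "('g::{linorder, ordered_comm_monoid_add} \<Rightarrow> 'm::{linorder, ordered_comm_monoid_add}) \<Rightarrow> bool" where
  "ordered_monoid_embedding \<iota> \<longleftrightarrow>
     \<iota> 0 = 0 \<and> (\<forall>\<alpha> \<beta>. \<iota> (\<alpha> + \<beta>) = \<iota> \<alpha> + \<iota> \<beta>) \<and> (\<forall>\<alpha> \<beta>. \<iota> \<alpha> \<le> \<iota> \<beta> \<longleftrightarrow> \<alpha> \<le> \<beta>)"

text \<open>
  The inclusion of \<open>\<Gamma>\<^sub>v\<close> in \<open>M\<close> as an ordered submonoid is an embedding \<open>\<iota>\<close>.
  Since \<open>v\<close> is onto \<open>\<Gamma>\<^sub>v\<close>, the embedding is determined by \<open>w\<close>.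
\<close>

definition extends_valuation ::
    "'a set \<Rightarrow> ('a \<Rightarrow> 'g::linordered_ab_group_add top) \<Rightarrow>
     ('a \<Rightarrow> 'm::{linorder, ordered_comm_monoid_add} top) \<Rightarrow> bool" where
  "extends_valuation F v w \<longleftrightarrow>
     (\<exists>\<iota>. ordered_monoid_embedding \<iota> \<and> (\<forall>a\<in>F. w a = map_top \<iota> (v a)))"

definition is_field_of_fractions :: "('a, 'b) ring_scheme \<Rightarrow> 'a set \<Rightarrow> bool" where
  "is_field_of_fractions E R \<longleftrightarrow>
     (\<forall>x\<in>carrier E. \<exists>r\<in>R. \<exists>s\<in>R - {\<zero>\<^bsub>E\<^esub>}. x = r \<otimes>\<^bsub>E\<^esub> inv\<^bsub>E\<^esub> s)"

text \<open>
  \<open>\<W>\<^sub>R\<close>, for quasi-valuations with values in a given \<open>'m\<close>. Different members of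
  \<open>\<W>\<^sub>R\<close> may have different monoids, so the relations below are heterogeneous
  in the monoid types.
\<close>

definition qvals ::
    "('a, 'b) ring_scheme \<Rightarrow> 'a set \<Rightarrow> ('a \<Rightarrow> 'g::linordered_ab_group_add top) \<Rightarrow> 'a set \<Rightarrow>
     ('a \<Rightarrow> 'm::{linorder, ordered_comm_monoid_add} top) set" where
  "qvals E F v R = {w. quasi_valuation E w \<and> extends_valuation F v w \<and> val_ring E w = R}"

definition qv_equiv ::
    "('a, 'b) ring_scheme \<Rightarrow> ('a \<Rightarrow> 'm::linorder top) \<Rightarrow> ('a \<Rightarrow> 'n::linorder top) \<Rightarrow> bool" where
  "qv_equiv E w1 w2 \<longleftrightarrow> (\<forall>x\<in>carrier E. \<forall>y\<in>carrier E. w1 x < w1 y \<longleftrightarrow> w2 x < w2 y)"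

definition qv_coarser ::
    "('a, 'b) ring_scheme \<Rightarrow> ('a \<Rightarrow> 'm::linorder top) \<Rightarrow> ('a \<Rightarrow> 'n::linorder top) \<Rightarrow> bool" where
  "qv_coarser E w1 w2 \<longleftrightarrow> (\<forall>x\<in>carrier E. \<forall>y\<in>carrier E. w1 x < w1 y \<longrightarrow> w2 x < w2 y)"

text \<open>The class \<open>[w]\<close> of \<open>w\<close> among the members of \<open>\<W>\<^sub>R\<close> with values in \<open>'m\<close>.\<close>

definition qv_class ::
    "('a, 'b) ring_scheme \<Rightarrow> 'a set \<Rightarrow> ('a \<Rightarrow> 'g::linordered_ab_group_add top) \<Rightarrow> 'a set \<Rightarrow>
     ('a \<Rightarrow> 'm::{linorder, ordered_comm_monoid_add} top) \<Rightarrow>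
     ('a \<Rightarrow> 'm top) set" where
  "qv_class E F v R w = {w' \<in> qvals E F v R. qv_equiv E w w'}"

definition qv_class_le ::
    "('a, 'b) ring_scheme \<Rightarrow> ('a \<Rightarrow> 'm::linorder top) set \<Rightarrow> ('a \<Rightarrow> 'n::linorder top) set \<Rightarrow> bool" where
  "qv_class_le E C1 C2 \<longleftrightarrow> (\<exists>w1\<in>C1. \<exists>w2\<in>C2. qv_coarser E w1 w2)"

lemma qv_class_le_iff:
  assumes "w1 \<in> qvals E F v R" and "w2 \<in> qvals E F v R"
  shows "qv_class_le E (qv_class E F v R w1) (qv_class E F v R w2) \<longleftrightarrow> qv_coarser E w1 w2"
proof
  assume "qv_coarser E w1 w2"
  moreover have "w1 \<in> qv_class E F v R w1" "w2 \<in> qv_class E F v R w2"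
    using assms by (auto simp: qv_class_def qv_equiv_def)
  ultimately show "qv_class_le E (qv_class E F v R w1) (qv_class E F v R w2)"
    unfolding qv_class_le_def by blast
qed (auto simp: qv_class_le_def qv_class_def qv_equiv_def qv_coarser_def)


section \<open>The filter quasi-valuation\<close>

text \<open>\<open>S\<^sub>x\<close> and \<open>v(S\<^sub>x)\<close>; here \<open>a <#\<^bsub>E\<^esub> R\<close> is \<open>aR\<close>.\<close>

definition filter_support ::
    "('a, 'b) ring_scheme \<Rightarrow> 'a set \<Rightarrow> ('a \<Rightarrow> 'g::linordered_ab_group_add top) \<Rightarrow> 'a set \<Rightarrow>
     'a \<Rightarrow> 'a set" where
  "filter_support E F v R x = {a \<in> val_ring (E\<lparr>carrier := F\<rparr>) v. x \<in> a <#\<^bsub>E\<^esub> R}"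

definition filter_values ::
    "('a, 'b) ring_scheme \<Rightarrow> 'a set \<Rightarrow> ('a \<Rightarrow> 'g::linordered_ab_group_add top) \<Rightarrow> 'a set \<Rightarrow>
     'a \<Rightarrow> 'g set" where
  "filter_values E F v R x = {\<gamma>. \<exists>a\<in>filter_support E F v R x. v a = Value \<gamma>}"

definition filter_qv_on_ring ::
    "('a, 'b) ring_scheme \<Rightarrow> 'a set \<Rightarrow> ('a \<Rightarrow> 'g::linordered_ab_group_add top) \<Rightarrow> 'a set \<Rightarrow>
     'a \<Rightarrow> 'g cut top" where
  "filter_qv_on_ring E F v R x =
     (if x = \<zero>\<^bsub>E\<^esub> then \<infinity> else Value (cut_above (filter_values E F v R x)))"

text \<open>
  The extension to \<open>E\<close>: the unique value of \<open>w\<^sub>v(r) - v(s)\<close> over all representations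
  \<open>x = r s\<^sup>-\<^sup>1\<close> with \<open>r \<in> R\<close> and \<open>0 \<noteq> s \<in> O\<^sub>v\<close>. Subtracting \<open>\<gamma>\<close> is adding the
  principal cut of \<open>-\<gamma>\<close>.
\<close>

definition filter_qv ::
    "('a, 'b) ring_scheme \<Rightarrow> 'a set \<Rightarrow> ('a \<Rightarrow> 'g::linordered_ab_group_add top) \<Rightarrow> 'a set \<Rightarrow>
     'a \<Rightarrow> 'g cut top" where
  "filter_qv E F v R x =
     (THE c. \<exists>r\<in>R. \<exists>s\<in>val_ring (E\<lparr>carrier := F\<rparr>) v - {\<zero>\<^bsub>E\<^esub>}. \<exists>\<gamma>.
        x = r \<otimes>\<^bsub>E\<^esub> inv\<^bsub>E\<^esub> s \<and> v s = Value \<gamma> \<and>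
        c = filter_qv_on_ring E F v R r + Value (principal_cut (- \<gamma>)))"

end

theory Submission
  imports Defs
begin

text \<open>
  For \<open>x \<noteq> 0\<close> the filter quasi-valuation \<open>w\<^sub>v(x)\<close> is the cut whose left set consists of the
  values \<open>v(a)\<close> with \<open>a \<in> F\<^sup>\<times>\<close> and \<open>x/a \<in> R\<close>. If \<open>w\<^sub>v(x) < w\<^sub>v(y)\<close> and \<open>y \<noteq> 0\<close>, then some
  \<open>a \<in> F\<^sup>\<times>\<close> satisfies \<open>y/a \<in> R\<close> and \<open>x/a \<notin> R\<close>, so \<open>w(y/a) \<ge> 0 > w(x/a)\<close> for every quasi-valuation
  \<open>w\<close> with \<open>O\<^sub>w = R\<close>; multiplying by \<open>a\<close> and by \<open>a\<inverse>\<close> yields \<open>w(x) < w(y)\<close>. If \<open>y = 0\<close>, then \<open>x\<close> is a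
  unit of \<open>E\<close>, and \<open>w(x) = \<infinity>\<close> would force \<open>w(1) = \<infinity>\<close>.
\<close>

section \<open>Preliminaries on the adjoined infinity, principal cuts and polynomial
  evaluation\<close>

lemma zero_le_Value_iff: "(0::'m::{linorder, zero} top) \<le> Value a \<longleftrightarrow> 0 \<le> a"
  by (simp add: zero_top_def)

text \<open>Supplies the inclusion of \<Gamma> into its cut monoid that
  \<open>extends_valuation\<close> asks for.\<close>

lemma ordered_monoid_embedding_principal_cut:
  "ordered_monoid_embedding (principal_cut :: 'g::linordered_ab_group_add \<Rightarrow> 'g cut)"
proof -
  have "principal_cut (\<alpha> + \<beta>) = principal_cut \<alpha> + principal_cut \<beta>" for \<alpha> \<beta> :: 'g
  proof (rule cut_left_inject[THEN iffD1], rule Set.set_eqI)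
    fix \<gamma>
    show "\<gamma> \<in> cut_left (principal_cut (\<alpha> + \<beta>)) \<longleftrightarrow>
        \<gamma> \<in> cut_left (principal_cut \<alpha> + principal_cut \<beta>)"
    proof
      assume "\<gamma> \<in> cut_left (principal_cut (\<alpha> + \<beta>))"
      then have "\<gamma> - \<beta> \<le> \<alpha>" and "\<gamma> = (\<gamma> - \<beta>) + \<beta>"
        by (simp_all add: cut_left_principal_cut diff_le_eq)
      then show "\<gamma> \<in> cut_left (principal_cut \<alpha> + principal_cut \<beta>)"
        unfolding cut_left_plus cut_left_principal_cut by blast
    qed (auto simp: cut_left_plus cut_left_principal_cut intro: add_mono)
  qed
  then show ?thesis
    by (auto simp: ordered_monoid_embedding_def zero_cut_def less_eq_cut_def
        cut_left_principal_cut)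
qed

text \<open>Clearing denominators: \<open>d\<close> moves the coefficients into \<open>S\<close>,
  and \<open>s [^] k\<close> turns each power of \<open>t\<close>, the inverse of \<open>s\<close>,
  into a power of \<open>s\<close>. The bound on the length says that the degree is at most
  \<open>k\<close>.\<close>

lemma (in cring) power_mult_eval_inverse_mem:
  assumes "subring S R" and "s \<in> S" and "t \<in> carrier R" and "s \<otimes> t = \<one>" and "d \<in> carrier R"
    and "set p \<subseteq> carrier R" and "\<forall>c\<in>set p. d \<otimes> c \<in> S" and "length p \<le> Suc k"
  shows "s [^] k \<otimes> (d \<otimes> eval p t) \<in> S"
  using assms(6-8)
proof (induction p)
  case Nil
  have "s \<in> carrier R" using assms(1,2) subringE(1) by blast
  then show ?case using assms(5) subringE(2)[OF assms(1)] by simp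
next
  case (Cons c q)
  let ?n = "length q"
  have s: "s \<in> carrier R" using assms(1,2) subringE(1) by blast
  have pow_S: "s [^] m \<in> S" for m :: nat
    by (induction m) (use assms(2) subringE(3,6)[OF assms(1)] in auto)
  have carr: "c \<in> carrier R" "eval q t \<in> carrier R"
    using Cons.prems(1) assms(3) by (auto intro: eval_in_carrier)
  \<comment> \<open>The length bound gives \<open>?n \<le> k\<close>, so the truncated difference is
    a genuine one; it counts the factors \<open>s\<close> that survive cancellation against
    \<open>t [^] ?n\<close>.\<close>
  have "s [^] k = s [^] (k - ?n) \<otimes> s [^] ?n"
    using s Cons.prems(3) by (simp add: nat_pow_mult)
  then have "s [^] k \<otimes> t [^] ?n = s [^] (k - ?n) \<otimes> (s \<otimes> t) [^] ?n"
    using s assms(3) by (simp add: m_assoc nat_pow_distrib)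
  then have st: "s [^] k \<otimes> t [^] ?n = s [^] (k - ?n)"
    using s assms(4) by simp
  have "s [^] k \<otimes> (d \<otimes> eval (c # q) t) =
      (d \<otimes> c) \<otimes> (s [^] k \<otimes> t [^] ?n) \<oplus> s [^] k \<otimes> (d \<otimes> eval q t)"
    using s carr assms(3,5) by (simp add: r_distr m_ac)
  also have "\<dots> \<in> S"
    unfolding st using Cons pow_S
    by (intro subringE(7)[OF assms(1)] subringE(6)[OF assms(1), of "d \<otimes> c"]) auto
  finally show ?case .
qed

section \<open>Arithmetic of \<open>v\<close> on \<open>F\<close> and its link with membership in
  \<open>R\<close>\<close>

locale valued_extension = field E for E :: "('e, 'b) ring_scheme" (structure) +
  fixes F R :: "'e set" and v :: "'e \<Rightarrow> 'g::linordered_ab_group_add top"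
  assumes subfield_F: "subfield F E"
    and val: "valuation (E\<lparr>carrier := F\<rparr>) v"
    and subring_R: "subring R E"
    and R_Int_F: "R \<inter> F = val_ring (E\<lparr>carrier := F\<rparr>) v"
begin

lemmas F_closed = subringE[OF subfieldE(1)[OF subfield_F]]
lemmas R_closed = subringE[OF subring_R]

lemma F_carrier [simp]: "a \<in> F \<Longrightarrow> a \<in> carrier E"
  using F_closed(1) by blast

lemma R_carrier [simp]: "a \<in> R \<Longrightarrow> a \<in> carrier E"
  using R_closed(1) by blast

lemma inv_F: "a \<in> F \<Longrightarrow> a \<noteq> \<zero> \<Longrightarrow> inv a \<in> F"
  using subfield_m_inv(1)[OF subfield_F, of a] by blast

lemma inv_carrier: "a \<in> carrier E \<Longrightarrow> a \<noteq> \<zero> \<Longrightarrow> inv a \<in> carrier E"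
  using field_Units by simp

lemma inv_cancel:
  assumes "a \<in> carrier E" "a \<noteq> \<zero>"
  shows "a \<otimes> inv a = \<one>" "inv a \<otimes> a = \<one>"
  using assms field_Units by auto

lemma inv_nonzero: "a \<in> carrier E \<Longrightarrow> a \<noteq> \<zero> \<Longrightarrow> inv a \<noteq> \<zero>"
  using inv_cancel inv_carrier by (metis l_null one_not_zero)

lemma v_infinity_iff: "a \<in> F \<Longrightarrow> v a = \<infinity> \<longleftrightarrow> a = \<zero>"
  using val by (simp add: valuation_def)

lemma v_mult: "a \<in> F \<Longrightarrow> b \<in> F \<Longrightarrow> v (a \<otimes> b) = v a + v b"
  using val by (simp add: valuation_def)

lemma v_surj: obtains a where "a \<in> F" "v a = Value \<gamma>"
proof -
  have "\<exists>a\<in>F. v a = Value \<gamma>"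
    using val by (simp add: valuation_def)
  then show ?thesis using that by blast
qed

lemma v_nonzero: "a \<in> F \<Longrightarrow> v a = Value \<gamma> \<Longrightarrow> a \<noteq> \<zero>"
  using v_infinity_iff by (metis top.distinct(1))

lemma v_finite:
  assumes "a \<in> F" "a \<noteq> \<zero>" obtains \<gamma> where "v a = Value \<gamma>"
  using v_infinity_iff[OF assms(1)] assms(2) by (cases "v a") auto

lemma v_one: "v \<one> = Value 0"
proof -
  obtain \<gamma> where "v \<one> = Value \<gamma>"
    using v_finite[of \<one>] F_closed(3) by auto
  with v_mult[of \<one> \<one>] F_closed(3) show ?thesis by simp
qed

lemma v_inv:
  assumes "a \<in> F" "v a = Value \<gamma>"
  shows "v (inv a) = Value (- \<gamma>)"
proof -
  have a: "a \<noteq> \<zero>" "inv a \<in> F"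
    using v_nonzero[OF assms] inv_F[OF assms(1)] by auto
  with inv_nonzero assms(1) obtain \<delta> where \<delta>: "v (inv a) = Value \<delta>"
    by (metis F_carrier v_finite)
  have "\<gamma> + \<delta> = 0"
    using v_mult[OF assms(1) a(2)] v_one assms(2) \<delta> inv_cancel(1)[of a] assms(1) a(1) by simp
  then show ?thesis using \<delta> by (simp add: eq_neg_iff_add_eq_0 add.commute)
qed

lemma mem_R_iff: "a \<in> F \<Longrightarrow> a \<in> R \<longleftrightarrow> 0 \<le> v a"
  using R_Int_F by (auto simp: val_ring_def)

lemma ratio_mem_R_iff:
  assumes "a \<in> F" "v a = Value \<alpha>" "b \<in> F" "v b = Value \<beta>"
  shows "inv a \<otimes> b \<in> R \<longleftrightarrow> \<alpha> \<le> \<beta>"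
proof -
  have a: "inv a \<in> F" using v_nonzero inv_F assms by blast
  have "v (inv a \<otimes> b) = Value (\<beta> - \<alpha>)"
    using v_mult[OF a assms(3)] v_inv[OF assms(1,2)] assms(4) by simp
  then show ?thesis
    using mem_R_iff[of "inv a \<otimes> b"] F_closed(6)[OF a assms(3)] by (simp add: zero_le_Value_iff)
qed

section \<open>Left sets of the cuts and their behaviour under the ring operations\<close>

text \<open>Here \<open>a\<close> ranges over all of \<open>F\<close> instead of
  \<open>O\<^sub>v\<close>, so negative values occur and the set makes sense for every
  \<open>x\<close> in \<open>E\<close> without choosing a fraction.\<close>

definition divisor_values :: "'e \<Rightarrow> 'g set" where
  "divisor_values x = {\<gamma>. \<exists>a\<in>F. v a = Value \<gamma> \<and> inv a \<otimes> x \<in> R}"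

text \<open>Write x/a = (b/a)(x/b), where b/a lies in \<open>R\<close> because its value is
  nonnegative. This yields both downward closure and independence of the chosen
  \<open>a\<close>.\<close>

lemma inv_mult_mem_R_antimono:
  assumes "a \<in> F" "v a = Value \<alpha>" "b \<in> F" "v b = Value \<beta>" "\<alpha> \<le> \<beta>"
    and "x \<in> carrier E" "inv b \<otimes> x \<in> R"
  shows "inv a \<otimes> x \<in> R"
proof -
  have b: "b \<noteq> \<zero>" "inv b \<in> carrier E" and a: "inv a \<in> carrier E"
    using v_nonzero inv_carrier assms by (metis F_carrier)+
  have "inv a \<otimes> x = inv a \<otimes> (b \<otimes> inv b) \<otimes> x"
    using inv_cancel assms a b by simp
  also have "\<dots> = (inv a \<otimes> b) \<otimes> (inv b \<otimes> x)"
    using assms a b by (simp add: m_assoc)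
  also have "\<dots> \<in> R"
    using ratio_mem_R_iff assms by (intro R_closed(6)[of "inv a \<otimes> b" "inv b \<otimes> x"]) auto
  finally show ?thesis .
qed

text \<open>Any single element of value \<gamma> decides membership: two such elements differ by a
  unit of the valuation ring, which is contained in \<open>R\<close>.\<close>

lemma divisor_values_iff:
  assumes "a \<in> F" "v a = Value \<gamma>" "x \<in> carrier E"
  shows "\<gamma> \<in> divisor_values x \<longleftrightarrow> inv a \<otimes> x \<in> R"
  using inv_mult_mem_R_antimono[OF assms(1,2) _ _ order_refl assms(3)] assms
  by (auto simp: divisor_values_def)

lemma divisor_values_downward:
  assumes "x \<in> carrier E" "\<beta> \<in> divisor_values x" "\<alpha> \<le> \<beta>"
  shows "\<alpha> \<in> divisor_values x"
proof -
  obtain a where "a \<in> F" "v a = Value \<alpha>" by (rule v_surj)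
  then show ?thesis
    using assms inv_mult_mem_R_antimono[of a \<alpha>] by (auto simp: divisor_values_def)
qed

lemma zero_mem_divisor_values_iff: "x \<in> carrier E \<Longrightarrow> 0 \<in> divisor_values x \<longleftrightarrow> x \<in> R"
  using divisor_values_iff[OF F_closed(3) v_one] by simp

text \<open>Because (cx)/(ac) = x/a, scaling by an element of \<open>F\<close> translates the left
  set by its value.\<close>

lemma divisor_values_mult_F:
  assumes "c \<in> F" "v c = Value \<gamma>" "x \<in> carrier E"
  shows "\<alpha> + \<gamma> \<in> divisor_values (c \<otimes> x) \<longleftrightarrow> \<alpha> \<in> divisor_values x"
proof -
  obtain a where a: "a \<in> F" "v a = Value \<alpha>" by (rule v_surj)
  have nz: "a \<noteq> \<zero>" "c \<noteq> \<zero>" using v_nonzero assms a by auto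
  have carr: "inv a \<in> carrier E" "inv c \<in> carrier E" using nz assms a by (auto intro: inv_carrier)
  have "inv (a \<otimes> c) = inv a \<otimes> inv c"
    using a assms nz carr inv_cancel
    by (intro comm_inv_char) (simp_all add: m_ac)
  also have "\<dots> \<otimes> (c \<otimes> x) = inv a \<otimes> (inv c \<otimes> c) \<otimes> x"
    using carr assms by (simp add: m_assoc)
  also have "\<dots> = inv a \<otimes> x"
    using carr assms nz inv_cancel by simp
  finally have "inv (a \<otimes> c) \<otimes> (c \<otimes> x) = inv a \<otimes> x" .
  moreover have "v (a \<otimes> c) = Value (\<alpha> + \<gamma>)" "a \<otimes> c \<in> F"
    using v_mult a assms F_closed(6) by auto
  ultimately show ?thesis
    using divisor_values_iff[of "a \<otimes> c" "\<alpha> + \<gamma>" "c \<otimes> x"] divisor_values_iff[OF a assms(3)] assms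
    by simp
qed

section \<open>The filter quasi-valuation described directly on \<open>E\<close>, as a member of
  \<open>qvals\<close>\<close>

text \<open>A form of the filter quasi-valuation free of fractions and definite descriptions. Zero
  is separate because its divisor values fill \<Gamma>, whose cut is still below
  \<infinity>.\<close>

definition filter_cut :: "'e \<Rightarrow> 'g cut top" where
  "filter_cut x = (if x = \<zero> then \<infinity> else Value (cut_of_left (divisor_values x)))"

lemma cut_left_divisor_values:
  "x \<in> carrier E \<Longrightarrow> cut_left (cut_of_left (divisor_values x)) = divisor_values x"
  by (rule cut_left_of_left) (rule divisor_values_downward)

lemma Value_le_filter_cut_iff:
  assumes "x \<in> carrier E" "x \<noteq> \<zero>"
  shows "Value A \<le> filter_cut x \<longleftrightarrow> cut_left A \<subseteq> divisor_values x"
  using assms by (simp add: filter_cut_def less_eq_cut_def cut_left_divisor_values)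

text \<open>The product (x/a)(y/b) lies in \<open>R\<close>, so 0 is among its divisor values;
  multiplying by \<open>a \<otimes> b\<close> shifts this 0 to \<alpha> + \<beta>.\<close>

lemma divisor_values_mult:
  assumes "x \<in> carrier E" "y \<in> carrier E" "\<alpha> \<in> divisor_values x" "\<beta> \<in> divisor_values y"
  shows "\<alpha> + \<beta> \<in> divisor_values (x \<otimes> y)"
proof -
  obtain a where a: "a \<in> F" "v a = Value \<alpha>" "inv a \<otimes> x \<in> R"
    using assms(3) by (auto simp: divisor_values_def)
  obtain b where b: "b \<in> F" "v b = Value \<beta>" "inv b \<otimes> y \<in> R"
    using assms(4) by (auto simp: divisor_values_def)
  have nz: "a \<noteq> \<zero>" "b \<noteq> \<zero>" using v_nonzero a b by auto
  have carr: "inv a \<in> carrier E" "inv b \<in> carrier E" using nz a b by (auto intro: inv_carrier)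
  have "0 \<in> divisor_values ((inv a \<otimes> x) \<otimes> (inv b \<otimes> y))"
    using R_closed(6)[OF a(3) b(3)] zero_mem_divisor_values_iff by simp
  moreover have "(a \<otimes> b) \<otimes> ((inv a \<otimes> x) \<otimes> (inv b \<otimes> y)) = (a \<otimes> inv a) \<otimes> (b \<otimes> inv b) \<otimes> (x \<otimes> y)"
    using a b carr assms by (simp add: m_ac)
  moreover have "\<dots> = x \<otimes> y" using inv_cancel nz a b assms by simp
  moreover have "v (a \<otimes> b) = Value (\<alpha> + \<beta>)" "a \<otimes> b \<in> F"
    using v_mult a b F_closed(6) by auto
  ultimately show ?thesis
    using divisor_values_mult_F[of "a \<otimes> b" "\<alpha> + \<beta>" "(inv a \<otimes> x) \<otimes> (inv b \<otimes> y)" 0] carr assms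
    by simp
qed

text \<open>One and the same \<open>a\<close> of value \<gamma> tests both summands, so closure of
  \<open>R\<close> under addition suffices.\<close>

lemma divisor_values_add:
  assumes "x \<in> carrier E" "y \<in> carrier E" "\<gamma> \<in> divisor_values x" "\<gamma> \<in> divisor_values y"
  shows "\<gamma> \<in> divisor_values (x \<oplus> y)"
proof -
  obtain a where a: "a \<in> F" "v a = Value \<gamma>" by (rule v_surj)
  have "inv a \<in> carrier E" using v_nonzero[OF a] a by (auto intro: inv_carrier)
  with assms a show ?thesis
    using R_closed(7) by (simp add: divisor_values_iff r_distr)
qed

lemma quasi_valuation_filter_cut: "quasi_valuation E filter_cut"
  unfolding quasi_valuation_def
proof (intro conjI ballI)
  show "ring E" by (rule ring_axioms)
  show "filter_cut \<zero> = \<infinity>" by (simp add: filter_cut_def)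
  fix x y assume xy: "x \<in> carrier E" "y \<in> carrier E"
  show "filter_cut x + filter_cut y \<le> filter_cut (x \<otimes> y)"
  proof (cases "x = \<zero> \<or> y = \<zero>")
    case False
    then have "x \<otimes> y \<noteq> \<zero>" using xy integral by blast
    moreover have "filter_cut x + filter_cut y =
        Value (cut_of_left (divisor_values x) + cut_of_left (divisor_values y))"
      using False by (simp add: filter_cut_def)
    ultimately show ?thesis
      using xy by (auto simp: Value_le_filter_cut_iff cut_left_plus cut_left_divisor_values
          intro: divisor_values_mult)
  qed (use xy in \<open>auto simp: filter_cut_def\<close>)
  show "min (filter_cut x) (filter_cut y) \<le> filter_cut (x \<oplus> y)"
  proof (cases "x = \<zero> \<or> y = \<zero> \<or> x \<oplus> y = \<zero>")
    case True
    then show ?thesis using xy by (auto simp: filter_cut_def min_def)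
  next
    case False
    then obtain A where A: "min (filter_cut x) (filter_cut y) = Value A"
      by (cases "filter_cut x \<le> filter_cut y") (auto simp: filter_cut_def min_def)
    then have "Value A \<le> filter_cut x" "Value A \<le> filter_cut y"
      by (metis min.cobounded1, metis min.cobounded2)
    then show ?thesis
      using False xy unfolding A by (auto simp: Value_le_filter_cut_iff intro: divisor_values_add)
  qed
qed

lemma extends_valuation_filter_cut: "extends_valuation F v filter_cut"
  unfolding extends_valuation_def
proof (intro exI conjI ballI)
  show "ordered_monoid_embedding (principal_cut :: 'g \<Rightarrow> 'g cut)"
    by (rule ordered_monoid_embedding_principal_cut)
  fix b assume b: "b \<in> F"
  show "filter_cut b = map_top principal_cut (v b)"
  proof (cases "b = \<zero>")
    case True
    then show ?thesis using v_infinity_iff[OF b] by (simp add: filter_cut_def)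
  next
    case False
    then obtain \<beta> where \<beta>: "v b = Value \<beta>" using v_finite b by blast
    \<comment> \<open>For \<open>b\<close> in \<open>F\<close> the condition b/a \<in> R only
      compares values, so the left set is the ray ending at \<beta>.\<close>
    have "\<alpha> \<in> divisor_values b \<longleftrightarrow> \<alpha> \<le> \<beta>" for \<alpha>
      by (metis v_surj divisor_values_iff ratio_mem_R_iff b \<beta> F_carrier)
    then have "divisor_values b = cut_left (principal_cut \<beta>)"
      by (auto simp: cut_left_principal_cut)
    then have "cut_of_left (divisor_values b) = principal_cut \<beta>"
      using b by (metis cut_left_inject cut_left_divisor_values F_carrier)
    then show ?thesis using False \<beta> by (simp add: filter_cut_def)
  qed
qed

lemma val_ring_filter_cut: "val_ring E filter_cut = R"
proof -
  have "0 \<le> filter_cut x \<longleftrightarrow> x \<in> R" if "x \<in> carrier E" for x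
  proof (cases "x = \<zero>")
    case False
    \<comment> \<open>The ray is the left set of the zero cut; by downward closure only its endpoint
      has to be tested, and \<open>a = \<one>\<close> tests it.\<close>
    have "{..0} \<subseteq> divisor_values x \<longleftrightarrow> 0 \<in> divisor_values x"
      using divisor_values_downward[OF that] by auto
    then show ?thesis
      using False that zero_mem_divisor_values_iff
      by (simp add: zero_top_def Value_le_filter_cut_iff zero_cut_def cut_left_principal_cut)
  qed (simp add: filter_cut_def R_closed(2))
  then show ?thesis by (auto simp: val_ring_def)
qed

lemma filter_cut_in_qvals: "filter_cut \<in> qvals E F v R"
  using quasi_valuation_filter_cut extends_valuation_filter_cut val_ring_filter_cut
  by (simp add: qvals_def)

section \<open>Minimality among the members of \<open>qvals\<close>\<close>

lemma filter_cut_coarsest: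
  fixes w :: "'e \<Rightarrow> 'm::{linorder, ordered_comm_monoid_add} top"
  assumes w: "w \<in> qvals E F v R" and xy: "x \<in> carrier E" "y \<in> carrier E"
    and less: "filter_cut x < filter_cut y"
  shows "w x < w y"
proof -
  obtain \<iota> where \<iota>: "ordered_monoid_embedding \<iota>" "\<And>a. a \<in> F \<Longrightarrow> w a = map_top \<iota> (v a)"
    using w by (auto simp: qvals_def extends_valuation_def)
  have wz: "w \<zero> = \<infinity>" and w_mult: "\<And>a b. a \<in> carrier E \<Longrightarrow> b \<in> carrier E \<Longrightarrow> w a + w b \<le> w (a \<otimes> b)"
    and w_nonneg: "\<And>a. a \<in> carrier E \<Longrightarrow> 0 \<le> w a \<longleftrightarrow> a \<in> R"
    using w by (auto simp: qvals_def quasi_valuation_def val_ring_def)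
  have xnz: "x \<noteq> \<zero>" using less by (auto simp: filter_cut_def)
  show ?thesis
  proof (cases "y = \<zero>")
    case True
    have "w x \<noteq> \<infinity>"
    proof
      assume "w x = \<infinity>"
      then have "w \<one> = \<infinity>"
        using w_mult[of x "inv x"] inv_cancel[OF xy(1) xnz] inv_carrier[OF xy(1) xnz] xy
        by (cases "w \<one>") auto
      \<comment> \<open>As \<open>w\<close> extends \<open>v\<close>, the value of
        \<open>\<one>\<close> is the image of 0 and hence finite.\<close>
      then show False using \<iota>(2)[of \<one>] v_one F_closed(3) by simp
    qed
    then show ?thesis using True wz by (cases "w x") auto
  next
    case False
    then have "divisor_values x \<subset> divisor_values y"
      using less xnz xy by (simp add: filter_cut_def less_cut_def cut_left_divisor_values)
    then obtain \<gamma> where "\<gamma> \<in> divisor_values y" "\<gamma> \<notin> divisor_values x" by blast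
    moreover obtain a where a: "a \<in> F" "v a = Value \<gamma>" by (rule v_surj)
    ultimately have R: "inv a \<otimes> y \<in> R" "inv a \<otimes> x \<notin> R"
      using divisor_values_iff[OF a] xy by auto
    have nz: "a \<noteq> \<zero>" by (rule v_nonzero[OF a])
    then have inv_a: "inv a \<in> F" "inv a \<in> carrier E" using inv_F a by auto
    have wa: "w a = Value (\<iota> \<gamma>)" "w (inv a) = Value (\<iota> (- \<gamma>))"
      using \<iota>(2) a inv_a v_inv[OF a] by auto
    \<comment> \<open>The target is only a monoid, but values of nonzero elements of
      \<open>F\<close> are invertible in it, so multiplication by \<open>a\<close> can be undone on
      values.\<close>
    have "\<iota> (- \<gamma>) + \<iota> \<gamma> = 0"
      using \<iota>(1) unfolding ordered_monoid_embedding_def by (metis add.left_inverse)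
    then have sum: "w (inv a) + w a = 0" by (simp add: wa zero_top_def)
    have "w a = w a + 0" by simp
    also have "\<dots> \<le> w a + w (inv a \<otimes> y)"
      using w_nonneg[of "inv a \<otimes> y"] R(1) by (intro add_left_mono) simp
    also have "\<dots> \<le> w (a \<otimes> (inv a \<otimes> y))"
      using w_mult a R(1) by simp
    also have "a \<otimes> (inv a \<otimes> y) = y"
      using a inv_a xy nz inv_cancel by (simp flip: m_assoc)
    finally have wy: "w a \<le> w y" .
    show ?thesis
    \<comment> \<open>Addition is only weakly monotone, so strictness comes by contradiction:
      \<open>w a \<le> w x\<close> would put x/a into \<open>R\<close>.\<close>
    proof (rule ccontr)
      assume "\<not> w x < w y"
      with wy have "w a \<le> w x" by simp
      then have "0 \<le> w (inv a) + w x"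
        using add_left_mono[of "w a" "w x" "w (inv a)"] by (simp add: sum)
      also have "\<dots> \<le> w (inv a \<otimes> x)" using w_mult inv_a xy by simp
      finally show False using w_nonneg[of "inv a \<otimes> x"] R(2) inv_a xy by simp
    qed
  qed
qed

section \<open>Agreement with the definition through supports and fractions\<close>

text \<open>The support admits only \<open>a\<close> of nonnegative value, hence yields the
  nonnegative part of the divisor values. As \<open>r\<close> lies in \<open>R\<close>, that part
  contains 0, is cofinal, and generates the same cut.\<close>

lemma filter_qv_on_ring_eq:
  assumes "r \<in> R"
  shows "filter_qv_on_ring E F v R r = filter_cut r"
proof (cases "r = \<zero>")
  case False
  have mem_coset: "r \<in> a <# R \<longleftrightarrow> inv a \<otimes> r \<in> R" if "a \<in> F" "a \<noteq> \<zero>" for a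
  proof
    have a: "a \<in> carrier E" "inv a \<in> carrier E" using that by (auto intro: inv_carrier)
    assume "r \<in> a <# R"
    then obtain h where "h \<in> R" "r = a \<otimes> h" by (auto simp: l_coset_def)
    then show "inv a \<otimes> r \<in> R"
      using a that inv_cancel(2)[of a] by (simp flip: m_assoc)
  next
    have a: "a \<in> carrier E" "inv a \<in> carrier E" using that by (auto intro: inv_carrier)
    assume "inv a \<otimes> r \<in> R"
    moreover have "r = a \<otimes> (inv a \<otimes> r)"
      using a that assms inv_cancel(1)[of a] by (simp flip: m_assoc)
    ultimately show "r \<in> a <# R" unfolding l_coset_def by blast
  qed
  have "\<gamma> \<in> filter_values E F v R r \<longleftrightarrow> \<gamma> \<in> divisor_values r \<and> 0 \<le> \<gamma>" for \<gamma>
  proof -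
    have "\<gamma> \<in> filter_values E F v R r \<longleftrightarrow> (\<exists>a\<in>F. 0 \<le> v a \<and> v a = Value \<gamma> \<and> r \<in> a <# R)"
      by (auto simp: filter_values_def filter_support_def val_ring_def)
    also have "\<dots> \<longleftrightarrow> (\<exists>a\<in>F. 0 \<le> v a \<and> v a = Value \<gamma> \<and> inv a \<otimes> r \<in> R)"
      using mem_coset v_nonzero by (intro bex_cong refl conj_cong) metis+
    also have "\<dots> \<longleftrightarrow> \<gamma> \<in> divisor_values r \<and> 0 \<le> \<gamma>"
      unfolding divisor_values_def mem_Collect_eq by (metis zero_le_Value_iff)
    finally show ?thesis .
  qed
  then have "cut_left (cut_above (filter_values E F v R r)) =
      {\<alpha>. \<exists>\<beta>\<in>divisor_values r. 0 \<le> \<beta> \<and> \<alpha> \<le> \<beta>}"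
    by (auto simp: cut_left_cut_above)
  also have "\<dots> = divisor_values r"
  proof -
    \<comment> \<open>The witness is the larger of \<alpha> and 0.\<close>
    have "\<exists>\<beta>\<in>divisor_values r. 0 \<le> \<beta> \<and> \<alpha> \<le> \<beta>" if "\<alpha> \<in> divisor_values r" for \<alpha>
      using that assms zero_mem_divisor_values_iff[of r] linear[of 0 \<alpha>] by auto
    then show ?thesis using divisor_values_downward[of r] assms by auto
  qed
  finally have "cut_above (filter_values E F v R r) = cut_of_left (divisor_values r)"
    using assms by (metis cut_left_inject cut_left_divisor_values R_carrier)
  then show ?thesis using False by (simp add: filter_qv_on_ring_def filter_cut_def)
qed (simp add: filter_qv_on_ring_def filter_cut_def)

text \<open>By downward closure, adding the whole ray below -\<gamma> to a left set has the same
  effect as translating it by -\<gamma>.\<close>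

lemma filter_cut_divide_F:
  assumes "x \<in> carrier E" and s: "s \<in> F" "v s = Value \<gamma>"
  shows "filter_cut (x \<otimes> inv s) = filter_cut x + Value (principal_cut (- \<gamma>))"
proof (cases "x = \<zero>")
  case True
  have "inv s \<in> carrier E" using v_nonzero[OF s] s by (auto intro: inv_carrier)
  then show ?thesis using True by (simp add: filter_cut_def)
next
  case False
  have nz: "s \<noteq> \<zero>" by (rule v_nonzero[OF s])
  have inv_s: "inv s \<in> F" "inv s \<in> carrier E" using inv_F s nz by auto
  have xs: "x \<otimes> inv s \<in> carrier E" "x \<otimes> inv s \<noteq> \<zero>"
    using integral[of x "inv s"] inv_nonzero[of s] s nz inv_s assms(1) False by auto
  have shift: "\<alpha> + - \<gamma> \<in> divisor_values (x \<otimes> inv s) \<longleftrightarrow> \<alpha> \<in> divisor_values x" for \<alpha>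
    using divisor_values_mult_F[OF inv_s(1) v_inv[OF s] assms(1)] m_comm[OF assms(1) inv_s(2)]
    by simp
  have "cut_of_left (divisor_values x) + principal_cut (- \<gamma>) =
      cut_of_left (divisor_values (x \<otimes> inv s))"
  proof (rule cut_left_inject[THEN iffD1], rule Set.set_eqI)
    fix \<delta>
    have "\<delta> \<in> cut_left (cut_of_left (divisor_values x) + principal_cut (- \<gamma>)) \<longleftrightarrow>
        (\<exists>\<alpha> \<beta>. \<delta> = \<alpha> + \<beta> \<and> \<alpha> \<in> divisor_values x \<and> \<beta> \<le> - \<gamma>)"
      by (simp add: cut_left_plus cut_left_divisor_values[OF assms(1)] cut_left_principal_cut)
    also have "\<dots> \<longleftrightarrow> \<delta> \<in> divisor_values (x \<otimes> inv s)"
    proof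
      assume "\<exists>\<alpha> \<beta>. \<delta> = \<alpha> + \<beta> \<and> \<alpha> \<in> divisor_values x \<and> \<beta> \<le> - \<gamma>"
      then obtain \<alpha> \<beta> where *: "\<delta> = \<alpha> + \<beta>" "\<alpha> \<in> divisor_values x" "\<beta> \<le> - \<gamma>" by blast
      then show "\<delta> \<in> divisor_values (x \<otimes> inv s)"
        using divisor_values_downward[OF xs(1), of "\<alpha> + - \<gamma>" \<delta>] shift[of \<alpha>]
          add_left_mono[of \<beta> "- \<gamma>" \<alpha>] by auto
    next
      assume "\<delta> \<in> divisor_values (x \<otimes> inv s)"
      then have "\<delta> = (\<delta> + \<gamma>) + - \<gamma> \<and> \<delta> + \<gamma> \<in> divisor_values x \<and> - \<gamma> \<le> - \<gamma>"
        using shift[of "\<delta> + \<gamma>"] by simp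
      then show "\<exists>\<alpha> \<beta>. \<delta> = \<alpha> + \<beta> \<and> \<alpha> \<in> divisor_values x \<and> \<beta> \<le> - \<gamma>" by blast
    qed
    finally show "\<delta> \<in> cut_left (cut_of_left (divisor_values x) + principal_cut (- \<gamma>)) \<longleftrightarrow>
        \<delta> \<in> cut_left (cut_of_left (divisor_values (x \<otimes> inv s)))"
      using cut_left_divisor_values[OF xs(1)] by simp
  qed
  then show ?thesis using False xs(2) by (simp add: filter_cut_def)
qed

text \<open>Every admissible representation of \<open>x\<close> produces
  \<open>filter_cut x\<close>, which does not mention the representation. The given fraction
  provides existence, so the definite description is well defined.\<close>

lemma filter_qv_eq_filter_cut:
  assumes r: "r \<in> R" and s: "s \<in> R \<inter> F - {\<zero>}" and x: "x = r \<otimes> inv s"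
  shows "filter_qv E F v R x = filter_cut x"
  unfolding filter_qv_def R_Int_F[symmetric]
proof (rule the_equality)
  obtain \<gamma> where \<gamma>: "v s = Value \<gamma>" using s v_finite[of s] by auto
  then have "filter_cut x = filter_qv_on_ring E F v R r + Value (principal_cut (- \<gamma>))"
    using filter_cut_divide_F[of r s \<gamma>] r s x filter_qv_on_ring_eq by simp
  then show "\<exists>r\<in>R. \<exists>s\<in>R \<inter> F - {\<zero>}. \<exists>\<gamma>. x = r \<otimes> inv s \<and> v s = Value \<gamma> \<and>
      filter_cut x = filter_qv_on_ring E F v R r + Value (principal_cut (- \<gamma>))"
    using r s x \<gamma> by blast
qed (auto simp: filter_cut_divide_F filter_qv_on_ring_eq)

section \<open>Fractions with denominators in \<open>F\<close>\<close>

text \<open>Each element of \<open>F\<close> has a denominator in the valuation ring, since it or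
  its inverse lies there; multiplying these denominators along the list serves all entries.\<close>

lemma common_denominator:
  assumes "set p \<subseteq> F"
  shows "\<exists>d\<in>R \<inter> F - {\<zero>}. \<forall>c\<in>set p. d \<otimes> c \<in> R"
  using assms
proof (induction p)
  case Nil
  then show ?case using R_closed(3) F_closed(3) one_not_zero by auto
next
  case (Cons c p)
  then obtain d where d: "d \<in> R" "d \<in> F" "d \<noteq> \<zero>" "\<forall>c\<in>set p. d \<otimes> c \<in> R" by auto
  have c: "c \<in> F" using Cons.prems by simp
  \<comment> \<open>A denominator for the new entry: \<open>\<one>\<close> if \<open>c\<close> is in
    \<open>R\<close>, and \<open>inv c\<close> otherwise.\<close>
  obtain e where e: "e \<in> R" "e \<in> F" "e \<noteq> \<zero>" "e \<otimes> c \<in> R"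
  proof (cases "c \<in> R")
    case True
    then show ?thesis using that[of \<one>] R_closed(3) F_closed(3) c by simp
  next
    case False
    then have nz: "c \<noteq> \<zero>" using R_closed(2) by blast
    then obtain \<gamma> where \<gamma>: "v c = Value \<gamma>" using v_finite c by blast
    have "\<gamma> < 0" using False mem_R_iff[OF c] \<gamma> by (simp add: zero_le_Value_iff)
    then have "0 \<le> v (inv c)" using v_inv[OF c \<gamma>] by (simp add: zero_le_Value_iff)
    then have "inv c \<in> R" "inv c \<in> F" "inv c \<noteq> \<zero>"
      using mem_R_iff inv_F[OF c nz] inv_nonzero c nz by auto
    then show ?thesis using that[of "inv c"] inv_cancel(2)[of c] nz c R_closed(3) by simp
  qed
  have "(e \<otimes> d) \<otimes> c' \<in> R" if "c' \<in> set (c # p)" for c'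
  proof -
    have "c' \<in> carrier E" using that Cons.prems by auto
    then have "(e \<otimes> d) \<otimes> c' = d \<otimes> (e \<otimes> c')" "(e \<otimes> d) \<otimes> c' = e \<otimes> (d \<otimes> c')"
      using d e by (simp_all add: m_ac)
    then show ?thesis using that d e R_closed(6) by (metis set_ConsD)
  qed
  moreover have "e \<otimes> d \<in> R \<inter> F - {\<zero>}"
    using d e R_closed(6) F_closed(6) integral[of e d] by auto
  ultimately show ?case by blast
qed

text \<open>
  An algebraic equation \<open>c\<^sub>n t\<^sup>n + \<dots> + c\<^sub>0 = 0\<close> over \<open>R \<inter> F\<close> for \<open>t = s\<inverse>\<close>, multiplied by \<open>s\<^sup>n\<^sup>-\<^sup>1\<close>,
  exhibits \<open>c\<^sub>n t\<close> as an element of \<open>R\<close>.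
\<close>

lemma inverse_eq_fraction_over_F:
  assumes "finite_dimension F (carrier E)" and s: "s \<in> R" "s \<noteq> \<zero>"
  obtains u d where "u \<in> R" "d \<in> R \<inter> F - {\<zero>}" "inv s = u \<otimes> inv d"
proof -
  let ?t = "inv s"
  have t: "?t \<in> carrier E" "?t \<noteq> \<zero>" "s \<otimes> ?t = \<one>"
    using s inv_carrier inv_nonzero inv_cancel by auto
  have "(algebraic over F) ?t"
    using finite_dimension_imp_algebraic[OF subfield_F carrier_is_subring assms(1)] t by blast
  then obtain p where p: "p \<in> carrier (F[X])" "p \<noteq> []" "eval p ?t = \<zero>"
    using algebraicE[OF subfieldE(1)[OF subfield_F] t(1)] by blast
  then obtain c q where cq: "p = c # q" by (cases p) auto
  have c: "c \<in> F" "c \<noteq> \<zero>" "set q \<subseteq> F"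
    using p(1) unfolding cq univ_poly_carrier[symmetric] polynomial_def by auto
  have q_carr: "set q \<subseteq> carrier E" using c(3) F_closed(1) by blast
  then have ev: "eval q ?t \<in> carrier E" using t(1) by (rule eval_in_carrier)
  have eq: "c \<otimes> ?t [^] length q \<oplus> eval q ?t = \<zero>" using p(3) cq by simp
  \<comment> \<open>A constant equation would force the leading coefficient \<open>c\<close> to
    vanish, so the degree is a successor.\<close>
  have "q \<noteq> []" using eq c by auto
  then obtain k where k: "length q = Suc k" by (cases q) auto
  \<comment> \<open>The coefficients lie merely in \<open>F\<close>; multiplication by
    \<open>d\<close> brings them into \<open>R\<close>.\<close>
  obtain d where d: "d \<in> R" "d \<in> F" "d \<noteq> \<zero>" "\<forall>b\<in>set (c # q). d \<otimes> b \<in> R"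
    using common_denominator[of "c # q"] c by auto
  have D: "d \<otimes> c \<in> R \<inter> F - {\<zero>}"
    using d c F_closed(6) integral[of d c] by auto
  let ?u = "s [^] k \<otimes> (d \<otimes> eval q ?t)"
  have u: "?u \<in> R"
    using power_mult_eval_inverse_mem[OF subring_R s(1) t(1,3), of d q k] d q_carr k by simp
  \<comment> \<open>The exponent \<open>k\<close> is one less than the degree, so exactly one factor
    \<open>?t\<close> is left in the leading term.\<close>
  have "s [^] k \<otimes> ?t [^] Suc k = (s \<otimes> ?t) [^] k \<otimes> ?t"
    using s t(1) by (simp add: nat_pow_distrib m_assoc)
  then have st: "s [^] k \<otimes> ?t [^] Suc k = ?t" using t by simp
  have "\<zero> = s [^] k \<otimes> (d \<otimes> (c \<otimes> ?t [^] Suc k \<oplus> eval q ?t))"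
    using eq k s d by simp
  also have "\<dots> = (d \<otimes> c) \<otimes> (s [^] k \<otimes> ?t [^] Suc k) \<oplus> ?u"
    using s d c ev t(1) by (simp add: r_distr m_ac del: nat_pow_Suc)
  finally have "(d \<otimes> c) \<otimes> ?t \<oplus> ?u = \<zero>" unfolding st by simp
  then have Dt: "(d \<otimes> c) \<otimes> ?t = \<ominus> ?u"
    using d c t(1) u by (intro minus_equality[symmetric]) auto
  have D_inv: "inv (d \<otimes> c) \<in> carrier E" "(d \<otimes> c) \<otimes> inv (d \<otimes> c) = \<one>"
    using D inv_carrier inv_cancel(1) by auto
  have "?t = ((d \<otimes> c) \<otimes> inv (d \<otimes> c)) \<otimes> ?t" using D_inv t(1) by simp
  also have "\<dots> = ((d \<otimes> c) \<otimes> ?t) \<otimes> inv (d \<otimes> c)"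
    using D_inv(1) t(1) d c by (simp add: m_ac)
  finally have "?t = (\<ominus> ?u) \<otimes> inv (d \<otimes> c)" using Dt by simp
  then show ?thesis using that[of "\<ominus> ?u" "d \<otimes> c"] u D R_closed(5) by blast
qed

text \<open>Replacing 1/s by u/d moves the denominator from \<open>R\<close> to the valuation ring,
  which is the kind of fraction that \<open>filter_qv\<close> is built on.\<close>

lemma fraction_over_F:
  assumes "finite_dimension F (carrier E)" and "is_field_of_fractions E R" and "x \<in> carrier E"
  obtains r s where "r \<in> R" "s \<in> R \<inter> F - {\<zero>}" "x = r \<otimes> inv s"
proof -
  obtain r s where rs: "r \<in> R" "s \<in> R" "s \<noteq> \<zero>" "x = r \<otimes> inv s"
    using assms(2,3) unfolding is_field_of_fractions_def by blast
  obtain u d where ud: "u \<in> R" "d \<in> R \<inter> F - {\<zero>}" "inv s = u \<otimes> inv d"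
    using inverse_eq_fraction_over_F[OF assms(1) rs(2,3)] by blast
  then have "x = (r \<otimes> u) \<otimes> inv d"
    using rs inv_carrier[of d] by (simp add: m_assoc)
  then show ?thesis using that[of "r \<otimes> u" d] R_closed(6) rs(1) ud by blast
qed

end

section \<open>Transfer to \<open>filter_qv\<close>\<close>

text \<open>All conditions look only at values on the carrier. This matters because
  \<open>filter_qv\<close> and \<open>filter_cut\<close> are compared only there.\<close>

lemma qvals_cong:
  assumes "w \<in> qvals E F v R" and "F \<subseteq> carrier E" and "ring E"
    and "\<And>x. x \<in> carrier E \<Longrightarrow> w' x = w x"
  shows "w' \<in> qvals E F v R"
proof -
  interpret ring E by (rule assms(3))
  have "extends_valuation F v w'"
    using assms(1,2,4) unfolding qvals_def extends_valuation_def by (auto simp: subset_iff)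
  then show ?thesis
    using assms(1,4) by (auto simp: qvals_def quasi_valuation_def val_ring_def)
qed

theorem proposition10p12:
  fixes E :: "('e, 'b) ring_scheme"
    and F R :: "'e set"
    and v :: "'e \<Rightarrow> 'g::linordered_ab_group_add top"
  assumes "field E"
    and "subfield F E"
    and "ring.finite_dimension E F (carrier E)"
    and "valuation (E\<lparr>carrier := F\<rparr>) v"
    and "subring R E"
    and "is_field_of_fractions E R"
    and "R \<inter> F = val_ring (E\<lparr>carrier := F\<rparr>) v"
  shows "filter_qv E F v R \<in> qvals E F v R
    \<and> (\<forall>w \<in> (qvals E F v R :: ('e \<Rightarrow> 'm::{linorder, ordered_comm_monoid_add} top) set).
           qv_class_le E (qv_class E F v R (filter_qv E F v R)) (qv_class E F v R w))
    \<and> (\<forall>w \<in> (qvals E F v R :: ('e \<Rightarrow> 'm top) set). \<forall>x\<in>carrier E. \<forall>y\<in>carrier E.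
           filter_qv E F v R x < filter_qv E F v R y \<longrightarrow> w x < w y)"
proof -
  interpret E: valued_extension E F R v
    using assms by (simp add: valued_extension_def valued_extension_axioms_def)
  have eq: "filter_qv E F v R x = E.filter_cut x" if "x \<in> carrier E" for x
    using E.fraction_over_F[OF assms(3,6) that] E.filter_qv_eq_filter_cut by metis
  have mem: "filter_qv E F v R \<in> qvals E F v R"
    using E.filter_cut_in_qvals E.F_closed(1) E.ring_axioms eq by (rule qvals_cong)
  have less: "w x < w y"
    if "w \<in> qvals E F v R" "x \<in> carrier E" "y \<in> carrier E"
      "filter_qv E F v R x < filter_qv E F v R y"
    for w :: "'e \<Rightarrow> 'm top" and x y
    using that E.filter_cut_coarsest[of w x y] by (simp add: eq)
  then have "qv_coarser E (filter_qv E F v R) w"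
    if "w \<in> qvals E F v R" for w :: "'e \<Rightarrow> 'm top"
    using that by (simp add: qv_coarser_def)
  \<comment> \<open>Comparison of classes reduces to comparison of the chosen representatives, both
    of which belong to \<open>qvals\<close>.\<close>
  with mem less show ?thesis by (simp add: qv_class_le_iff)
qed

end
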